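(* Let $\mathcal{F}$ be a non-degenerate pencil of conics in $\mathbb{C}P^2$ and let $\Gamma_1,\Gamma_2,\Gamma_3,\Gamma_4$ be four pairwise distinct conics in $\mathcal{F}$. Let $\mathcal{C}$ be a non-degenerate conic, not belonging to $\mathcal{F}$, going through three base points of $\mathcal{F}$. Denote by $M_i$ the fourth intersection point of $\mathcal{C}$ with $\Gamma_i$ ($i=1,2,3,4$). Then $$(\Gamma_1,\Gamma_2,\Gamma_3,\Gamma_4)=(M_1,M_2,M_3,M_4)_{\mathcal{C}}.$$
   Context: We work in $\mathbb{C}P^2$. A conic is the zero set of a non-zero quadratic form on $\mathbb{C}^3$ (up to scalar), possibly degenerate; it is identified with a point of $\mathbb{P}(Q(\mathbb{C}^3))$, where $Q(\mathbb{C}^3)$ is the space of quadratic forms. A pencil of conics is a projective line in $\mathbb{P}(Q(\mathbb{C}^3))$. It is non-degenerate if it consists of all conics through four distinct points, no three collinear (its base points). The cross ratio of four distinct points on a projective line, in terms of an affine coordinate, is $(A,B,C,D)=\frac{(A-C)(B-D)}{(B-C)(A-D)}$. The cross ratio of four concurrent lines is their cross ratio as points of a line in the dual projective plane (equivalently, the cross ratio of their intersection points with any line not through the common point). The cross ratio $(\Gamma_1,\Gamma_2,\Gamma_3,\Gamma_4)$ of four conics in a pencil is their cross ratio as points of the projective line in $\mathbb{P}(Q(\mathbb{C}^3))$ which is the pencil. For four points $A,B,C,D$ on a non-degenerate conic $\mathcal{C}$, $(A,B,C,D)_{\mathcal{C}}$ is the cross ratio of the lines $(PA,PB,PC,PD)$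 for any other point $P\in\mathcal{C}$ (it is independent of $P$). Intersections are counted with multiplicity: the four intersection points of $\mathcal{C}$ and $\Gamma_i$ are the three given base points and $M_i$ (which may coincide with one of these base points in case of tangency). *)

theory Defs
  imports
    "HOL-Analysis.Analysis"
    "HOL-Complex_Analysis.Complex_Analysis"
    "HOL-Library.Function_Algebras"
begin

text \<open>
  The projective space of a complex vector space \<open>V\<close> is the set of one-dimensional subspaces of
  \<open>V\<close>. Linear and quadratic forms on $\mathbb{C}^3$ are functions, and the vector space structure
  on functions is the pointwise one.
\<close>

definition fscale :: "complex \<Rightarrow> ('v \<Rightarrow> complex) \<Rightarrow> 'v \<Rightarrow> complex" where
  "fscale c f = (\<lambda>x. c * f x)"

interpretation fn: vector_space fscale
  by unfold_locales (auto simp: fscale_def fun_eq_iff algebra_simps)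

definition proj_forms :: "('v \<Rightarrow> complex) set \<Rightarrow> ('v \<Rightarrow> complex) set set" where
  "proj_forms V = {fn.span {f} | f. f \<in> V \<and> f \<noteq> 0}"

definition proj_line :: "('v \<Rightarrow> complex) set \<Rightarrow> ('v \<Rightarrow> complex) set set \<Rightarrow> bool" where
  "proj_line V F \<longleftrightarrow> (\<exists>W\<subseteq>V. fn.subspace W \<and> fn.dim W = 2 \<and> F = proj_forms W)"

text \<open>
  An affine coordinate on the projective line of a plane with basis \<open>u, v\<close> sends the class of
  \<open>t u + v\<close> to \<open>t\<close>. For any four points of the line, the basis can be chosen such that none of them
  is the point at infinity (the class of \<open>u\<close>), and the value below does not depend on that choice
  when the points are pairwise distinct.
\<close>

definition cross_ratio ::
    "('v \<Rightarrow> complex) set \<Rightarrow> ('v \<Rightarrow> complex) set \<Rightarrow> ('v \<Rightarrow> complex) set \<Rightarrow> ('v \<Rightarrow> complex) set \<Rightarrow> complex"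
  where
  "cross_ratio A B C D = (THE r. \<exists>u v a b c d.
     u \<noteq> v \<and> fn.independent {u, v} \<and>
     A = fn.span {fscale a u + v} \<and> B = fn.span {fscale b u + v} \<and>
     C = fn.span {fscale c u + v} \<and> D = fn.span {fscale d u + v} \<and>
     r = ((a - c) * (b - d)) / ((b - c) * (a - d)))"

definition CP2 :: "(complex^3) set set" where
  "CP2 = {vec.span {x} | x. x \<noteq> 0}"

definition lies_on :: "(complex^3) set \<Rightarrow> (complex^3 \<Rightarrow> complex) set \<Rightarrow> bool" where
  "lies_on P X \<longleftrightarrow> (\<forall>f\<in>X. \<forall>x\<in>P. f x = 0)"

definition linear_forms :: "(complex^3 \<Rightarrow> complex) set" where
  "linear_forms = {f. Vector_Spaces.linear (*s) (*) f}"

text \<open>A line of the plane is a point of the dual projective plane.\<close>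

definition lines :: "(complex^3 \<Rightarrow> complex) set set" where
  "lines = proj_forms linear_forms"

definition line_through :: "(complex^3) set \<Rightarrow> (complex^3) set \<Rightarrow> (complex^3 \<Rightarrow> complex) set" where
  "line_through P Q = (THE L. L \<in> lines \<and> lies_on P L \<and> lies_on Q L)"

definition on_common_line :: "(complex^3) set set \<Rightarrow> bool" where
  "on_common_line T \<longleftrightarrow> (\<exists>L\<in>lines. \<forall>P\<in>T. lies_on P L)"

definition qform :: "complex^3^3 \<Rightarrow> complex^3 \<Rightarrow> complex" where
  "qform A = (\<lambda>x. \<Sum>i\<in>UNIV. \<Sum>j\<in>UNIV. A $ i $ j * x $ i * x $ j)"

definition quadratic_forms :: "(complex^3 \<Rightarrow> complex) set" where
  "quadratic_forms = {qform A | A. transpose A = A}"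

definition conics :: "(complex^3 \<Rightarrow> complex) set set" where
  "conics = proj_forms quadratic_forms"

definition nondegenerate_conic :: "(complex^3 \<Rightarrow> complex) set \<Rightarrow> bool" where
  "nondegenerate_conic C \<longleftrightarrow> (\<exists>A. transpose A = A \<and> det A \<noteq> 0 \<and> C = fn.span {qform A})"

definition pencil :: "(complex^3 \<Rightarrow> complex) set set \<Rightarrow> bool" where
  "pencil F \<longleftrightarrow> proj_line quadratic_forms F"

definition nondegenerate_pencil ::
    "(complex^3 \<Rightarrow> complex) set set \<Rightarrow> (complex^3) set set \<Rightarrow> bool" where
  "nondegenerate_pencil F S \<longleftrightarrow>
     pencil F \<and> S \<subseteq> CP2 \<and> card S = 4 \<and>
     (\<forall>T\<subseteq>S. card T = 3 \<longrightarrow> \<not> on_common_line T) \<and>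
     F = {\<Gamma>\<in>conics. \<forall>P\<in>S. lies_on P \<Gamma>}"

text \<open>
  The universal quantifier over the auxiliary point \<open>P\<close> makes the independence of \<open>P\<close> part of the
  defining property.
\<close>

definition conic_cross_ratio ::
    "(complex^3 \<Rightarrow> complex) set \<Rightarrow> (complex^3) set \<Rightarrow> (complex^3) set \<Rightarrow> (complex^3) set \<Rightarrow>
     (complex^3) set \<Rightarrow> complex"
  where
  "conic_cross_ratio \<C> A B C D = (THE r. \<forall>P\<in>CP2. lies_on P \<C> \<and> P \<notin> {A, B, C, D} \<longrightarrow>
     r = cross_ratio (line_through P A) (line_through P B) (line_through P C) (line_through P D))"

text \<open>
  \<open>\<gamma>\<close> is a lift to $\mathbb{C}^3$ of a holomorphic local parametrization of the curve \<open>X\<close> with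
  parameter value 0 at \<open>P\<close>. The parametrization is immersive at 0 exactly if the derivative of the
  lift does not lie in the line \<open>P\<close> spanned by \<open>\<gamma> 0\<close>.
\<close>

definition local_parametrization ::
    "(complex^3 \<Rightarrow> complex) set \<Rightarrow> (complex^3) set \<Rightarrow> (complex \<Rightarrow> complex^3) \<Rightarrow> bool" where
  "local_parametrization X P \<gamma> \<longleftrightarrow>
     (\<forall>k. (\<lambda>t. \<gamma> t $ k) analytic_on {0}) \<and>
     \<gamma> 0 \<in> P \<and> \<gamma> 0 \<noteq> 0 \<and> (\<chi> k. deriv (\<lambda>t. \<gamma> t $ k) 0) \<notin> P \<and>
     (\<forall>\<^sub>F t in nhds 0. \<forall>f\<in>X. f (\<gamma> t) = 0)"

text \<open>
  The intersection multiplicity at \<open>P\<close> of a curve \<open>X\<close> that is smooth at \<open>P\<close> with a curve \<open>Y\<close> not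
  containing the component of \<open>X\<close> through \<open>P\<close>: the order of vanishing at \<open>P\<close> of the equation of
  \<open>Y\<close> restricted to \<open>X\<close>. It depends neither on the local parametrization nor on the equation.
\<close>

definition intersection_multiplicity ::
    "(complex^3 \<Rightarrow> complex) set \<Rightarrow> (complex^3 \<Rightarrow> complex) set \<Rightarrow> (complex^3) set \<Rightarrow> nat" where
  "intersection_multiplicity X Y P =
     (if lies_on P X \<and> lies_on P Y then
        let \<gamma> = (SOME \<gamma>. local_parametrization X P \<gamma>); q = (SOME q. q \<in> Y \<and> q \<noteq> 0)
        in nat (zorder (\<lambda>t. q (\<gamma> t)) 0)
      else 0)"

end

theory Submission
  imports Defs
begin

text \<open>
  Take coordinates in which the three common base points are the vertices of the coordinate
  triangle. A conic through them has an equation \<open>n\<^sub>1 y\<^sub>2 y\<^sub>3 + n\<^sub>2 y\<^sub>1 y\<^sub>3 + n\<^sub>3 y\<^sub>1 y\<^sub>2 = 0\<close>, that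
  is, it is the preimage of the line \<open>n\<close> under the standard Cremona map
  \<open>\<phi> y = (y\<^sub>2 y\<^sub>3, y\<^sub>1 y\<^sub>3, y\<^sub>1 y\<^sub>2)\<close>. As \<open>\<phi> (\<phi> w) = w\<^sub>1 w\<^sub>2 w\<^sub>3 w\<close>, the conic \<open>\<C>\<close> with coefficients \<open>n\<close> is
  parametrized by \<open>\<phi>\<close> on the line \<open>n\<close>, and its fourth intersection with the conic with
  coefficients \<open>m\<close> is \<open>\<phi> (n \<times> m)\<close>. The line joining \<open>\<phi> w\<close> and \<open>\<phi> x\<close> on \<open>\<C>\<close> has the coefficients
  \<open>w\<^sub>k x\<^sub>k n\<^sub>k\<close>. Both steps are linear and, on the pencil, injective, so the map from \<open>\<Gamma>\<close> to the line
  joining \<open>P\<close> to the fourth intersection point is projective and preserves cross ratios.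
\<close>

no_notation fps_nth (infixl "$" 75)

section \<open>Cross ratios in homogeneous coordinates\<close>

lemma fn_span_singleton_scale: "c \<noteq> 0 \<Longrightarrow> fn.span {fscale c f} = fn.span {f}"
  by (rule fn.span_image_scale[of "{f}" "\<lambda>_. c", simplified])

lemma fn_span_singleton_eqD:
  assumes "fn.span {f} = fn.span {g}" "f \<noteq> 0"
  obtains c where "c \<noteq> 0" "f = fscale c g"
proof -
  have "f \<in> fn.span {g}" using assms(1) fn.span_superset[of "{f}"] by auto
  then obtain c where c: "f = fscale c g" by (auto simp: fn.span_singleton)
  with assms(2) have "c \<noteq> 0" by (auto simp: fscale_def fun_eq_iff)
  with c that show thesis by blast
qed

lemma vec_span_singleton_scale: "c \<noteq> 0 \<Longrightarrow> vec.span {c *s x} = vec.span {x :: complex^3}"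
  by (rule vec.span_image_scale[of "{x}" "\<lambda>_. c", simplified])

lemma vec_span_singleton_eqD:
  assumes "vec.span {x} = vec.span {y :: complex^3}" "x \<noteq> 0"
  obtains c where "c \<noteq> 0" "x = c *s y"
proof -
  have "x \<in> vec.span {y}" using assms(1) vec.span_superset[of "{x}"] by auto
  then obtain c where c: "x = c *s y" by (auto simp: vec.span_singleton)
  with assms(2) have "c \<noteq> 0" by auto
  with c that show thesis by blast
qed

text \<open>Stated on coefficients of an ordered pair, because the set \<open>{u, v}\<close>
  collapses when \<open>u = v\<close>; this is why \<open>lin_indep2_iff\<close> carries the clause
  \<open>u \<noteq> v\<close>.\<close>

definition lin_indep2 :: "('v \<Rightarrow> complex) \<Rightarrow> ('v \<Rightarrow> complex) \<Rightarrow> bool" where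
  "lin_indep2 u v \<longleftrightarrow> (\<forall>\<alpha> \<beta>. fscale \<alpha> u + fscale \<beta> v = 0 \<longrightarrow> \<alpha> = 0 \<and> \<beta> = 0)"

lemma lin_indep2_iff: "lin_indep2 u v \<longleftrightarrow> u \<noteq> v \<and> fn.independent {u, v}"
proof
  assume *: "lin_indep2 u v"
  have "u \<noteq> v"
  proof
    assume "u = v"
    then have "fscale 1 u + fscale (-1) v = 0" by (auto simp: fscale_def fun_eq_iff)
    with * have "(1::complex) = 0" unfolding lin_indep2_def by blast
    then show False by simp
  qed
  moreover from this * have "fn.independent {u, v}"
    by (subst fn.dependent_finite) (auto simp: lin_indep2_def)
  ultimately show "u \<noteq> v \<and> fn.independent {u, v}" by blast
next
  assume *: "u \<noteq> v \<and> fn.independent {u, v}"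
  show "lin_indep2 u v" unfolding lin_indep2_def
  proof (intro allI impI)
    fix \<alpha> \<beta> assume eq: "fscale \<alpha> u + fscale \<beta> v = 0"
    define g where "g = (\<lambda>x. if x = u then \<alpha> else \<beta>)"
    have "(\<Sum>x\<in>{u,v}. fscale (g x) x) = 0" using eq * by (auto simp: g_def)
    with * have "\<forall>x\<in>{u,v}. g x = 0" by (subst (asm) fn.dependent_finite) auto
    with * show "\<alpha> = 0 \<and> \<beta> = 0" by (auto simp: g_def split: if_splits)
  qed
qed

lemma lin_indep2_cong:
  assumes "lin_indep2 u v" "fscale a u + fscale b v = fscale a' u + fscale b' v"
  shows "a = a'" "b = b'"
proof -
  have "fscale (a - a') u + fscale (b - b') v = 0"
    using assms(2) by (auto simp: fscale_def fun_eq_iff algebra_simps)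
  then show "a = a'" "b = b'" using assms(1) unfolding lin_indep2_def by fastforce+
qed

text \<open>A change of basis multiplies every bracket \<open>s i * t j - s j * t i\<close> by its
  determinant, and rescaling a point multiplies the brackets containing its index. Each factor
  occurs equally often in numerator and denominator, so the quotient is invariant. The two goals of
  the definite description are a basis in which all four points are affine and independence of the
  chosen basis.\<close>

lemma cross_ratio_homogeneous:
  fixes A :: "nat \<Rightarrow> ('v \<Rightarrow> complex) set" and s t :: "nat \<Rightarrow> complex"
  assumes ind: "lin_indep2 u v"
    and A: "\<And>i. i \<in> {1..4} \<Longrightarrow> A i = fn.span {fscale (s i) u + fscale (t i) v}"
    and st: "\<And>i j. i \<in> {1..4} \<Longrightarrow> j \<in> {1..4} \<Longrightarrow> i \<noteq> j \<Longrightarrow> s i * t j - s j * t i \<noteq> 0"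
  shows "cross_ratio (A 1) (A 2) (A 3) (A 4) =
    ((s 1 * t 3 - s 3 * t 1) * (s 2 * t 4 - s 4 * t 2)) /
    ((s 2 * t 3 - s 3 * t 2) * (s 1 * t 4 - s 4 * t 1))" (is "_ = ?R")
  unfolding cross_ratio_def
proof (rule the_equality, goal_cases)
  case 1
  \<comment> \<open>Choose \<open>\<beta>\<close> so that none of the four points is the class of
    \<open>v - \<beta> u\<close>, which becomes the point at infinity. For \<open>t i = 0\<close>
    the quotient is 0 by convention; there \<open>s i \<noteq> 0\<close> follows from distinctness
    from another point.\<close>
  have "finite ((\<lambda>i. - s i / t i) ` {1..4})" by simp
  then obtain \<beta> where \<beta>: "\<beta> \<notin> (\<lambda>i. - s i / t i) ` {1..4}"
    using ex_new_if_finite infinite_UNIV_char_0 by blast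
  have nz: "s i + \<beta> * t i \<noteq> 0" if i: "i \<in> {1..4}" for i
  proof (cases "t i = 0")
    case True
    obtain j :: nat where "j \<in> {1..4}" "j \<noteq> i" using that[of 1] that[of 2] by (cases "i = 1") auto
    from st[OF i this(1)] this(2) True show ?thesis by auto
  next
    case False
    from \<beta> i have "\<beta> \<noteq> - s i / t i" by auto
    with False show ?thesis by (auto simp: field_simps add_eq_0_iff)
  qed
  \<comment> \<open>The affine coordinate comes from
    \<open>s u + t v = (s + \<beta> t) u + t (v - \<beta> u)\<close> after division by the first
    coefficient.\<close>
  define a where "a i = t i / (s i + \<beta> * t i)" for i
  define u' where "u' = v - fscale \<beta> u"
  have ind': "lin_indep2 u' u" unfolding lin_indep2_def
  proof (intro allI impI)
    fix x y assume "fscale x u' + fscale y u = 0"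
    then have "fscale (y - \<beta> * x) u + fscale x v = 0"
      by (auto simp: fscale_def fun_eq_iff algebra_simps u'_def)
    with ind have "y - \<beta> * x = 0" "x = 0" unfolding lin_indep2_def by blast+
    then show "x = 0 \<and> y = 0" by simp
  qed
  have A': "A i = fn.span {fscale (a i) u' + u}" if i: "i \<in> {1..4}" for i
  proof -
    have "fscale (s i) u + fscale (t i) v = fscale (s i + \<beta> * t i) (fscale (a i) u' + u)"
      using nz[OF i] by (auto simp: fscale_def fun_eq_iff field_simps u'_def a_def)
    then show ?thesis using A[OF i] fn_span_singleton_scale[OF nz[OF i]] by simp
  qed
  define p where "p i j = s i * t j - s j * t i" for i j
  have d: "a i - a j = - p i j / ((s i + \<beta> * t i) * (s j + \<beta> * t j))"
    if "i \<in> {1..4}" "j \<in> {1..4}" for i j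
    using nz[OF that(1)] nz[OF that(2)] by (simp add: a_def p_def divide_simps) algebra
  have "?R = ((a 1 - a 3) * (a 2 - a 4)) / ((a 2 - a 3) * (a 1 - a 4))"
    using nz[of 1] nz[of 2] nz[of 3] nz[of 4] by (simp add: d p_def[symmetric])
  with A'[of 1] A'[of 2] A'[of 3] A'[of 4] ind' show ?case
    unfolding lin_indep2_iff by (intro exI[of _ u'] exI[of _ u] exI[of _ "a 1"]
      exI[of _ "a 2"] exI[of _ "a 3"] exI[of _ "a 4"]) simp
next
  case (2 r)
  then obtain u' v' a b c d where *: "lin_indep2 u' v'"
     "A 1 = fn.span {fscale a u' + v'}" "A 2 = fn.span {fscale b u' + v'}"
     "A 3 = fn.span {fscale c u' + v'}" "A 4 = fn.span {fscale d u' + v'}"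
     "r = ((a - c) * (b - d)) / ((b - c) * (a - d))"
    unfolding lin_indep2_iff by blast
  define e where "e = (\<lambda>i::nat. if i = 1 then a else if i = 2 then b else if i = 3 then c else d)"
  have range: "i = 1 \<or> i = 2 \<or> i = 3 \<or> i = 4" if "i \<in> {1..4}" for i :: nat using that by auto
  have A': "A i = fn.span {fscale (e i) u' + v'}" if "i \<in> {1..4}" for i
    using range[OF that] * by (auto simp: e_def)
  have "\<exists>k. k \<noteq> 0 \<and> fscale (e i) u' + v' = fscale (k * s i) u + fscale (k * t i) v"
    if i: "i \<in> {1..4}" for i
  proof -
    have "fscale (e i) u' + v' \<noteq> 0"
    proof
      assume "fscale (e i) u' + v' = 0"
      then have "fscale (e i) u' + fscale 1 v' = 0" by (simp add: fscale_def)
      with *(1) have "(1::complex) = 0" unfolding lin_indep2_def by blast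
      then show False by simp
    qed
    from fn_span_singleton_eqD[OF _ this] A[OF i] A'[OF i] obtain k
      where "k \<noteq> 0" "fscale (e i) u' + v' = fscale k (fscale (s i) u + fscale (t i) v)" by metis
    then show ?thesis by (intro exI[of _ k]) (auto simp: fscale_def fun_eq_iff algebra_simps)
  qed
  then obtain k where k: "\<And>i. i \<in> {1..4} \<Longrightarrow> k i \<noteq> 0"
     "\<And>i. i \<in> {1..4} \<Longrightarrow> fscale (e i) u' + v' = fscale (k i * s i) u + fscale (k i * t i) v"
    by metis
  have e12: "e 1 \<noteq> e 2"
  proof
    assume "e 1 = e 2"
    then have eq: "fscale (k 1 * s 1) u + fscale (k 1 * t 1) v = fscale (k 2 * s 2) u + fscale (k 2 * t 2) v"
      using k(2)[of 1] k(2)[of 2] by simp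
    from lin_indep2_cong[OF ind this] k(1)[of 1] k(1)[of 2] have "s 1 * t 2 - s 2 * t 1 = 0"
      by simp algebra
    with st[of 1 2] show False by simp
  qed
  \<comment> \<open>Points 1 and 2 have different affine coordinates, so their two equations can be
    solved for \<open>u'\<close> and \<open>v'\<close>. The solutions have coordinates
    \<open>(\<alpha>, \<beta>)\<close> and \<open>(\<gamma>, \<delta>)\<close> in the basis
    \<open>u, v\<close>, and \<open>D\<close> below is the determinant of this base change.\<close>
  define \<alpha> \<beta> where "\<alpha> = (k 1 * s 1 - k 2 * s 2) / (e 1 - e 2)"
    and "\<beta> = (k 1 * t 1 - k 2 * t 2) / (e 1 - e 2)"
  define \<gamma> \<delta> where "\<gamma> = k 1 * s 1 - e 1 * \<alpha>" and "\<delta> = k 1 * t 1 - e 1 * \<beta>"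
  have u': "u' = fscale \<alpha> u + fscale \<beta> v"
  proof
    fix x
    have "e 1 * u' x + v' x = k 1 * s 1 * u x + k 1 * t 1 * v x"
      "e 2 * u' x + v' x = k 2 * s 2 * u x + k 2 * t 2 * v x"
      using fun_cong[OF k(2)[of 1], of x] fun_cong[OF k(2)[of 2], of x] by (auto simp: fscale_def)
    then have "(e 1 - e 2) * u' x = (k 1 * s 1 - k 2 * s 2) * u x + (k 1 * t 1 - k 2 * t 2) * v x"
      by algebra
    then show "u' x = (fscale \<alpha> u + fscale \<beta> v) x"
      using e12 by (simp add: \<alpha>_def \<beta>_def fscale_def divide_simps) (simp add: mult.commute)
  qed
  have v': "v' = fscale \<gamma> u + fscale \<delta> v"
  proof
    fix x
    have "e 1 * u' x + v' x = k 1 * s 1 * u x + k 1 * t 1 * v x"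
      using fun_cong[OF k(2)[of 1], of x] by (auto simp: fscale_def)
    then show "v' x = (fscale \<gamma> u + fscale \<delta> v) x"
      unfolding \<gamma>_def \<delta>_def u' by (simp add: fscale_def algebra_simps eq_diff_eq)
  qed
  have kst: "k i * s i = e i * \<alpha> + \<gamma>" "k i * t i = e i * \<beta> + \<delta>" if i: "i \<in> {1..4}" for i
  proof -
    have "fscale (k i * s i) u + fscale (k i * t i) v = fscale (e i * \<alpha> + \<gamma>) u + fscale (e i * \<beta> + \<delta>) v"
      using k(2)[OF i] unfolding u' v' by (auto simp: fscale_def fun_eq_iff algebra_simps)
    from lin_indep2_cong[OF ind this]
    show "k i * s i = e i * \<alpha> + \<gamma>" "k i * t i = e i * \<beta> + \<delta>" .
  qed
  define D where "D = \<alpha> * \<delta> - \<beta> * \<gamma>"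
  have br: "(k i * k j) * (s i * t j - s j * t i) = (e i - e j) * D"
    if i: "i \<in> {1..4}" and j: "j \<in> {1..4}" for i j
    using kst[OF i] kst[OF j] unfolding D_def by algebra
  define p where "p i j = s i * t j - s j * t i" for i j
  have "D \<noteq> 0" using br[of 1 2] k(1)[of 1] k(1)[of 2] st[of 1 2] by auto
  then have br': "e i - e j = k i * k j * p i j / D" if "i \<in> {1..4}" "j \<in> {1..4}" for i j
    using br[OF that] by (simp add: p_def field_simps)
  have "?R = ((e 1 - e 3) * (e 2 - e 4)) / ((e 2 - e 3) * (e 1 - e 4))"
    using \<open>D \<noteq> 0\<close> k(1)[of 1] k(1)[of 2] k(1)[of 3] k(1)[of 4]
    by (simp add: br' p_def[symmetric])
  then show ?case using *(6) by (simp add: e_def)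
qed

section \<open>The standard Cremona map\<close>

text \<open>Bilinear, without conjugation: \<open>cdot n x = 0\<close> is the equation of the line
  with coefficients \<open>n\<close>.\<close>

definition cdot :: "complex^3 \<Rightarrow> complex^3 \<Rightarrow> complex" where
  "cdot x y = x $ 1 * y $ 1 + x $ 2 * y $ 2 + x $ 3 * y $ 3"

text \<open>The vector product: on coordinate vectors it gives the join of two points, or the
  intersection of two lines.\<close>

definition cprod :: "complex^3 \<Rightarrow> complex^3 \<Rightarrow> complex^3" where
  "cprod x y = vector [x $ 2 * y $ 3 - x $ 3 * y $ 2,
                       x $ 3 * y $ 1 - x $ 1 * y $ 3,
                       x $ 1 * y $ 2 - x $ 2 * y $ 1]"

definition cremona :: "complex^3 \<Rightarrow> complex^3" where
  "cremona y = vector [y $ 2 * y $ 3, y $ 1 * y $ 3, y $ 1 * y $ 2]"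

lemma cprod_nth [simp]:
  "cprod x y $ 1 = x $ 2 * y $ 3 - x $ 3 * y $ 2"
  "cprod x y $ 2 = x $ 3 * y $ 1 - x $ 1 * y $ 3"
  "cprod x y $ 3 = x $ 1 * y $ 2 - x $ 2 * y $ 1"
  by (simp_all add: cprod_def vector_3)

lemma cremona_nth [simp]:
  "cremona y $ 1 = y $ 2 * y $ 3"
  "cremona y $ 2 = y $ 1 * y $ 3"
  "cremona y $ 3 = y $ 1 * y $ 2"
  by (simp_all add: cremona_def vector_3)

lemma vec3_eq_iff: "(x :: complex^3) = y \<longleftrightarrow> x $ 1 = y $ 1 \<and> x $ 2 = y $ 2 \<and> x $ 3 = y $ 3"
  by (simp add: vec_eq_iff forall_3)

lemma cdot_scale [simp]: "cdot (c *s x) y = c * cdot x y" "cdot x (c *s y) = c * cdot x y"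
  by (simp_all add: cdot_def algebra_simps)

lemma cdot_commute: "cdot x y = cdot y x"
  by (simp add: cdot_def)

lemma cdot_cprod [simp]: "cdot x (cprod x y) = 0" "cdot y (cprod x y) = 0"
  by (simp_all add: cdot_def algebra_simps)

lemma cprod_self [simp]: "cprod x x = 0" by (simp add: vec3_eq_iff)

lemma cprod_scale: "cprod (c *s x) y = c *s cprod x y" "cprod x (c *s y) = c *s cprod x y"
  by (simp_all add: vec3_eq_iff algebra_simps)

lemma cprod_cprod: "cprod z (cprod x y) = cdot z y *s x - cdot z x *s y"
  by (simp add: vec3_eq_iff cdot_def algebra_simps)

lemma cprod_eq_0D:
  assumes "cprod x y = 0" "y \<noteq> 0"
  obtains c where "x = c *s y"
proof -
  from assms(2) obtain k where k: "y $ k \<noteq> 0" by (auto simp: vec_eq_iff)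
  have "x $ i * y $ k = x $ k * y $ i" for i
    using assms(1) exhaust_3[of i] exhaust_3[of k] by (auto simp: vec3_eq_iff algebra_simps)
  then have "x = (x $ k / y $ k) *s y" using k by (auto simp: vec_eq_iff field_simps)
  then show thesis by (rule that)
qed

lemma cprod_of_orthogonal:
  assumes "cdot n x = 0" "cdot n y = 0" "n \<noteq> 0"
  obtains c where "cprod x y = c *s n"
proof -
  have "cprod n (cprod x y) = 0" using assms by (simp add: cprod_cprod)
  then have "cprod (cprod x y) n = 0" by (simp add: vec3_eq_iff algebra_simps)
  with assms(3) show thesis using cprod_eq_0D that by metis
qed

lemma cremona_scale: "cremona (c *s y) = c^2 *s cremona y"
  by (simp add: vec3_eq_iff power2_eq_square)

text \<open>Coordinate \<open>k\<close> of the left side factors as \<open>x $ k * y $ k\<close>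
  times the negative of coordinate \<open>k\<close> of \<open>cprod x y\<close>.\<close>

lemma cprod_cremona:
  assumes "cprod x y = c *s n"
  shows "cprod (cremona x) (cremona y) = (- c) *s (\<chi> k. x $ k * y $ k * n $ k)"
proof -
  have "x $ 2 * y $ 3 - x $ 3 * y $ 2 = c * n $ 1" "x $ 3 * y $ 1 - x $ 1 * y $ 3 = c * n $ 2"
    "x $ 1 * y $ 2 - x $ 2 * y $ 1 = c * n $ 3"
    using assms unfolding vec3_eq_iff by simp_all
  then show ?thesis unfolding vec3_eq_iff by simp algebra
qed

text \<open>A line whose coefficients are all nonzero misses the vertices of the coordinate
  triangle.\<close>

lemma two_coords_zeroD:
  fixes n y :: "complex^3"
  assumes "\<forall>k. n $ k \<noteq> 0" "cdot n y = 0" "y $ i = 0" "y $ j = 0" "i \<noteq> j"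
  shows "y = 0"
  using assms exhaust_3[of i] exhaust_3[of j] by (auto simp: cdot_def vec3_eq_iff)

lemma orthogonal_eq_scale:
  assumes "cdot n x = 0" "cdot m x = 0" "cprod n m \<noteq> 0"
  obtains c where "x = c *s cprod n m"
proof -
  have "cprod x (cprod n m) = 0"
    using assms by (simp add: cprod_cprod) (simp add: cdot_def vec3_eq_iff algebra_simps)
  then show thesis using assms(3) cprod_eq_0D that by metis
qed

text \<open>Off the triangle the map is its own inverse up to a scalar, so
  \<open>w = cremona y\<close> works. The only points of the conic on the triangle are the vertices,
  and a vertex is the image of the point where the line \<open>n\<close> meets the opposite
  side.\<close>

lemma cremona_surj_on_conic:
  fixes n y :: "complex^3"
  assumes n: "\<forall>k. n $ k \<noteq> 0" and y: "y \<noteq> 0" "cdot n (cremona y) = 0"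
  obtains w c where "w \<noteq> 0" "c \<noteq> 0" "cdot n w = 0" "cremona w = c *s y"
proof (cases "\<forall>k. y $ k \<noteq> 0")
  case True
  then have "cremona y \<noteq> 0" "y $ 1 * y $ 2 * y $ 3 \<noteq> 0"
    "cremona (cremona y) = (y $ 1 * y $ 2 * y $ 3) *s y"
    by (auto simp: vec3_eq_iff)
  with y(2) that show thesis by blast
next
  case False
  \<comment> \<open>When one coordinate vanishes, the equation reduces to a nonzero coefficient
    times the product of the other two coordinates, so a second one vanishes.\<close>
  with n y(2) consider "y $ 1 = 0" "y $ 2 = 0" | "y $ 1 = 0" "y $ 3 = 0" | "y $ 2 = 0" "y $ 3 = 0"
    by (auto simp: forall_3 cdot_def)
  then show thesis
  proof cases
    case 1
    with n y show thesis
      by (intro that[of "vector [n $ 2, - n $ 1, 0]" "- n $ 1 * n $ 2 / y $ 3"])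
        (auto simp: vec3_eq_iff cdot_def vector_3)
  next
    case 2
    with n y show thesis
      by (intro that[of "vector [n $ 3, 0, - n $ 1]" "- n $ 1 * n $ 3 / y $ 2"])
        (auto simp: vec3_eq_iff cdot_def vector_3)
  next
    case 3
    with n y show thesis
      by (intro that[of "vector [0, n $ 3, - n $ 2]" "- n $ 2 * n $ 3 / y $ 1"])
        (auto simp: vec3_eq_iff cdot_def vector_3)
  qed
qed

section \<open>Quadratic forms vanishing at the vertices\<close>

lemma qform_cdot: "qform A x = cdot x (A *v x)"
  by (simp add: qform_def cdot_def matrix_vector_mult_def sum_3 algebra_simps)

lemma cdot_matrix_left: "cdot (G *v x) y = cdot x (transpose G *v y)"
  by (simp add: cdot_def matrix_vector_mult_def transpose_def sum_3 algebra_simps)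

lemma qform_congruence: "qform A (G *v y) = qform (transpose G ** A ** G) y"
  by (simp add: qform_cdot cdot_matrix_left matrix_vector_mul_assoc matrix_mul_assoc)

text \<open>The value at a vertex is a diagonal entry of the matrix; the mixed monomials that remain
  are the coordinates of \<open>cremona y\<close>.\<close>

lemma qform_zero_diagonal:
  fixes A :: "complex^3^3"
  assumes "\<forall>k. qform A (axis k 1) = 0"
  shows "qform A y = cdot (vector [A$2$3 + A$3$2, A$1$3 + A$3$1, A$1$2 + A$2$1]) (cremona y)"
    and "A $ 1 $ 1 = 0" "A $ 2 $ 2 = 0" "A $ 3 $ 3 = 0"
proof -
  have ax: "axis k 1 $ j = (if k = j then 1 else (0::complex))" for k j :: 3
    by (simp add: axis_def)
  from assms show "A $ 1 $ 1 = 0" "A $ 2 $ 2 = 0" "A $ 3 $ 3 = 0"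
    by (simp_all add: forall_3 qform_def sum_3 ax)
  then show "qform A y = cdot (vector [A$2$3 + A$3$2, A$1$3 + A$3$1, A$1$2 + A$2$1]) (cremona y)"
    by (simp add: qform_def sum_3 cdot_def vector_3 algebra_simps)
qed

text \<open>For a nonzero power series the order is the subdegree, so the coefficient of degree one
  lies below it and vanishes. If the series is zero, the order says nothing, but the derivative is
  zero anyway.\<close>

lemma deriv_eq_0_of_zorder_eq_2:
  assumes "f analytic_on {0}" "nat (zorder f 0) = 2"
  shows "deriv f 0 = 0"
proof -
  define F where "F = fps_expansion f 0"
  from assms(1) have F: "f has_fps_expansion F"
    unfolding F_def using analytic_at_imp_has_fps_expansion_0 by blast
  have "fps_nth F 1 = 0"
  proof (cases "F = 0")
    case False
    have "zorder f 0 = int (subdegree F)"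
      using has_laurent_expansion_zorder_0[OF has_fps_expansion_to_laurent[THEN iffD1, THEN conjunct1, OF F]] False
      by (simp add: fls_subdegree_fls_to_fps)
    with assms(2) have "subdegree F = 2" by simp
    then show ?thesis by (intro nth_less_subdegree_zero) simp
  qed simp
  then show ?thesis by (simp add: F_def fps_expansion_def)
qed

section \<open>Conics through the vertices of a projective frame\<close>

text \<open>The columns of \<open>G\<close> represent the vertices of the triangle; \<open>G\<close>
  turns triangle coordinates into ambient ones and \<open>H\<close> turns them back.\<close>

locale frame =
  fixes G H :: "complex^3^3"
  assumes HG: "H ** G = mat 1" and GH: "G ** H = mat 1"
begin

lemma HG_vec [simp]: "H *v (G *v y) = y"
  by (simp add: matrix_vector_mul_assoc HG)

lemma GH_vec [simp]: "G *v (H *v x) = x"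
  by (simp add: matrix_vector_mul_assoc GH)

lemma G_eq_0_iff [simp]: "G *v y = 0 \<longleftrightarrow> y = 0"
  by (metis HG_vec matrix_vector_mult_0_right)

lemma H_eq_0_iff [simp]: "H *v x = 0 \<longleftrightarrow> x = 0"
  by (metis GH_vec matrix_vector_mult_0_right)

text \<open>In \<open>point\<close>, \<open>lform\<close> and \<open>cform\<close> the parameter
  vector refers to triangle coordinates, while the resulting points and forms live in the ambient
  space.\<close>

definition point :: "complex^3 \<Rightarrow> (complex^3) set" where
  "point y = vec.span {G *v y}"

definition lform :: "complex^3 \<Rightarrow> complex^3 \<Rightarrow> complex" where
  "lform l x = cdot l (H *v x)"

definition cform :: "complex^3 \<Rightarrow> complex^3 \<Rightarrow> complex" where
  "cform n x = cdot n (cremona (H *v x))"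

lemma point_scale: "c \<noteq> 0 \<Longrightarrow> point (c *s y) = point y"
  by (simp add: point_def vector_scalar_commute vec_span_singleton_scale)

lemma point_eqD:
  assumes "point x = point y" "x \<noteq> 0"
  obtains c where "c \<noteq> 0" "x = c *s y"
proof -
  have "G *v x \<noteq> 0" using assms(2) by simp
  then obtain c where "c \<noteq> 0" "G *v x = c *s (G *v y)"
    using assms(1) vec_span_singleton_eqD unfolding point_def by metis
  then have "x = c *s y" by (metis HG_vec vector_scalar_commute)
  with \<open>c \<noteq> 0\<close> that show thesis by blast
qed

lemma mem_point_iff: "x \<in> point y \<longleftrightarrow> (\<exists>c. H *v x = c *s y)"
proof -
  have "x = c *s (G *v y) \<longleftrightarrow> H *v x = c *s y" for c
    by (metis HG_vec GH_vec vector_scalar_commute)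
  then show ?thesis by (auto simp: point_def vec.span_singleton)
qed

lemma CP2_point:
  assumes "P \<in> CP2"
  obtains y where "y \<noteq> 0" "P = point y"
proof -
  from assms obtain x where x: "x \<noteq> 0" "P = vec.span {x}" by (auto simp: CP2_def)
  then have "P = point (H *v x)" by (simp add: point_def)
  moreover have "H *v x \<noteq> 0" using x(1) by simp
  ultimately show thesis using that by blast
qed

lemma point_in_CP2: "y \<noteq> 0 \<Longrightarrow> point y \<in> CP2"
  by (auto simp: CP2_def point_def intro!: exI[of _ "G *v y"])

lemma cform_eq_0_iff: "cform n = 0 \<longleftrightarrow> n = 0"
proof
  assume *: "cform n = 0"
  have "cdot n (cremona y) = 0" for y using fun_cong[OF *, of "G *v y"] by (simp add: cform_def)
  \<comment> \<open>The Cremona images of these three vectors are the unit vectors, so the values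
    are the coefficients of \<open>n\<close>.\<close>
  from this[of "vector [0,1,1]"] this[of "vector [1,0,1]"] this[of "vector [1,1,0]"]
  show "n = 0" by (simp add: cdot_def vec3_eq_iff vector_3)
qed (auto simp: cform_def cdot_def fun_eq_iff)

lemma lform_eq_0_iff: "lform l = 0 \<longleftrightarrow> l = 0"
proof
  assume *: "lform l = 0"
  have "cdot l y = 0" for y using fun_cong[OF *, of "G *v y"] by (simp add: lform_def)
  from this[of "vector [1,0,0]"] this[of "vector [0,1,0]"] this[of "vector [0,0,1]"]
  show "l = 0" by (simp add: cdot_def vec3_eq_iff vector_3)
qed (auto simp: lform_def cdot_def fun_eq_iff)

lemma cform_combination: "fscale s (cform m) + fscale t (cform n) = cform (s *s m + t *s n)"
  by (simp add: fun_eq_iff fscale_def cform_def cdot_def algebra_simps)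

lemma lform_combination: "fscale s (lform m) + fscale t (lform n) = lform (s *s m + t *s n)"
  by (simp add: fun_eq_iff fscale_def lform_def cdot_def algebra_simps)

lemma cform_scale: "fscale c (cform n) = cform (c *s n)"
  by (simp add: fun_eq_iff fscale_def cform_def cdot_def algebra_simps)

lemma lform_scale: "fscale c (lform n) = lform (c *s n)"
  by (simp add: fun_eq_iff fscale_def lform_def cdot_def algebra_simps)

lemma span_cform_scale: "c \<noteq> 0 \<Longrightarrow> fn.span {cform (c *s n)} = fn.span {cform n}"
  by (simp add: cform_scale[symmetric] fn_span_singleton_scale)

lemma span_lform_scale: "c \<noteq> 0 \<Longrightarrow> fn.span {lform (c *s l)} = fn.span {lform l}"
  by (simp add: lform_scale[symmetric] fn_span_singleton_scale)

lemma lies_on_cform_iff: "lies_on (point y) (fn.span {cform n}) \<longleftrightarrow> cdot n (cremona y) = 0"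
  (is "?L = ?R")
proof
  assume ?L
  moreover have "cform n \<in> fn.span {cform n}" "G *v y \<in> point y"
    by (auto simp: fn.span_base point_def vec.span_base)
  ultimately have "cform n (G *v y) = 0" by (auto simp: lies_on_def)
  then show ?R by (simp add: cform_def)
next
  assume ?R
  then show ?L
    by (auto simp: lies_on_def fn.span_singleton mem_point_iff fscale_def cform_def cremona_scale)
qed

lemma lies_on_lform_iff: "lies_on (point y) (fn.span {lform l}) \<longleftrightarrow> cdot l y = 0"
  (is "?L = ?R")
proof
  assume ?L
  moreover have "lform l \<in> fn.span {lform l}" "G *v y \<in> point y"
    by (auto simp: fn.span_base point_def vec.span_base)
  ultimately have "lform l (G *v y) = 0" by (auto simp: lies_on_def)
  then show ?R by (simp add: lform_def)
next
  assume ?R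
  then show ?L
    by (auto simp: lies_on_def fn.span_singleton mem_point_iff fscale_def lform_def)
qed

lemma lines_iff: "L \<in> lines \<longleftrightarrow> (\<exists>l. l \<noteq> 0 \<and> L = fn.span {lform l})"
proof
  assume "L \<in> lines"
  then obtain f where f: "Vector_Spaces.linear (*s) (*) f" "f \<noteq> 0" "L = fn.span {f}"
    by (auto simp: lines_def proj_forms_def linear_forms_def)
  interpret f: Vector_Spaces.linear "(*s)" "(*)" f by (rule f(1))
  \<comment> \<open>The coefficients of a linear form in triangle coordinates are its values on the
    columns of \<open>G\<close>.\<close>
  define l where "l = (\<chi> k. f (G *v axis k 1))"
  have "f x = lform l x" for x
  proof -
    have "x = G *v (H *v x)" by simp
    also have "H *v x = (H *v x) $ 1 *s axis 1 1 + (H *v x) $ 2 *s axis 2 1 + (H *v x) $ 3 *s axis 3 1"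
      by (simp add: vec3_eq_iff axis_def)
    finally have "f x = f (G *v ((H *v x) $ 1 *s axis 1 1 + (H *v x) $ 2 *s axis 2 1 + (H *v x) $ 3 *s axis 3 1))"
      by simp
    also have "\<dots> = lform l x"
      by (simp only: matrix_vector_right_distrib vector_scalar_commute f.add f.scale)
         (simp add: lform_def cdot_def l_def mult.commute)
    finally show ?thesis .
  qed
  then have "f = lform l" by blast
  with f lform_eq_0_iff show "\<exists>l. l \<noteq> 0 \<and> L = fn.span {lform l}" by blast
next
  assume "\<exists>l. l \<noteq> 0 \<and> L = fn.span {lform l}"
  then obtain l where l: "l \<noteq> 0" "L = fn.span {lform l}" by blast
  have "Vector_Spaces.linear (*s) (*) (lform l)"
    by unfold_locales (auto simp: lform_def cdot_def matrix_vector_right_distrib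
        vector_scalar_commute algebra_simps)
  with l lform_eq_0_iff show "L \<in> lines"
    by (auto simp: lines_def proj_forms_def linear_forms_def)
qed

lemma line_through_point:
  assumes "cprod x y \<noteq> 0"
  shows "line_through (point x) (point y) = fn.span {lform (cprod x y)}"
  unfolding line_through_def
proof (rule the_equality)
  show "fn.span {lform (cprod x y)} \<in> lines \<and> lies_on (point x) (fn.span {lform (cprod x y)}) \<and>
    lies_on (point y) (fn.span {lform (cprod x y)})"
    using assms lines_iff by (auto simp: lies_on_lform_iff cdot_commute)
next
  fix L assume L: "L \<in> lines \<and> lies_on (point x) L \<and> lies_on (point y) L"
  then obtain l where l: "l \<noteq> 0" "L = fn.span {lform l}" by (auto simp: lines_iff)
  with L have "cdot x l = 0" "cdot y l = 0"
    by (auto simp: lies_on_lform_iff cdot_commute)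
  then obtain c where c: "l = c *s cprod x y" using orthogonal_eq_scale assms by blast
  with l(1) have "c \<noteq> 0" by auto
  then show "L = fn.span {lform (cprod x y)}"
    unfolding l(2) c by (rule span_lform_scale)
qed

lemma quadratic_form_eq_cform:
  assumes "q \<in> quadratic_forms" "\<forall>k. q (G *v axis k 1) = 0"
  obtains n where "q = cform n"
proof -
  from assms obtain A where A: "q = qform A" by (auto simp: quadratic_forms_def)
  define A' where "A' = transpose G ** A ** G"
  have *: "q (G *v y) = qform A' y" for y by (simp add: A A'_def qform_congruence)
  with assms(2) have "\<forall>k. qform A' (axis k 1) = 0" by simp
  from qform_zero_diagonal(1)[OF this] obtain n where n: "\<And>y. qform A' y = cdot n (cremona y)"
    by blast
  have "q x = cform n x" for x using *[of "H *v x"] n by (simp add: cform_def)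
  then have "q = cform n" by blast
  then show thesis by (rule that)
qed

text \<open>In triangle coordinates the symmetric matrix has zero diagonal and the halves of the
  \<open>n $ k\<close> off it. Its determinant is twice the product of these three entries, and it
  differs from \<open>det A\<close> by the nonzero square of \<open>det G\<close>.\<close>

lemma nondegenerate_coeffs_nonzero:
  fixes n :: "complex^3"
  assumes "transpose A = A" "det A \<noteq> 0" "qform A = cform n"
  shows "\<forall>k. n $ k \<noteq> 0"
proof -
  define A' where "A' = transpose G ** A ** G"
  have "transpose A' = A'"
    by (simp add: A'_def matrix_transpose_mul assms(1) matrix_mul_assoc)
  moreover have "transpose A' $ i $ j = A' $ j $ i" for i j by (simp add: transpose_def)
  ultimately have sym: "A' $ i $ j = A' $ j $ i" for i j by simp
  have *: "qform A' y = cdot n (cremona y)" for y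
    using fun_cong[OF assms(3), of "G *v y"] by (simp add: A'_def qform_congruence cform_def)
  have "qform A' (axis k 1) = 0" for k
    using exhaust_3[of k] by (auto simp: * cdot_def axis_def)
  then have diag: "\<forall>k. qform A' (axis k 1) = 0" by blast
  note q = qform_zero_diagonal[OF diag]
  have n: "n $ 1 = 2 * A' $ 2 $ 3" "n $ 2 = 2 * A' $ 1 $ 3" "n $ 3 = 2 * A' $ 1 $ 2"
    using q(1)[of "vector [0,1,1]"] q(1)[of "vector [1,0,1]"] q(1)[of "vector [1,1,0]"]
    unfolding * sym[of 3 2] sym[of 3 1] sym[of 2 1] by (simp_all add: cdot_def vector_3)
  have "det (transpose G) * det G \<noteq> 0"
    using HG by (metis det_I det_mul det_transpose mult_eq_0_iff zero_neq_one)
  then have "det A' \<noteq> 0" using assms(2) by (simp add: A'_def det_mul)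
  moreover have "det A' = 2 * A' $ 1 $ 2 * A' $ 1 $ 3 * A' $ 2 $ 3"
    unfolding det_3 q(2-4) sym[of 3 2] sym[of 3 1] sym[of 2 1] by simp
  ultimately show ?thesis using n by (auto simp: forall_3)
qed

end

section \<open>Tangency at a vertex\<close>

text \<open>The differential of \<open>cremona\<close> at \<open>y\<close> applied to
  \<open>z\<close>.\<close>

definition cremona_diff :: "complex^3 \<Rightarrow> complex^3 \<Rightarrow> complex^3" where
  "cremona_diff y z = vector [y $ 2 * z $ 3 + y $ 3 * z $ 2,
                              y $ 1 * z $ 3 + y $ 3 * z $ 1,
                              y $ 1 * z $ 2 + y $ 2 * z $ 1]"

lemma cremona_diff_nth [simp]:
  "cremona_diff y z $ 1 = y $ 2 * z $ 3 + y $ 3 * z $ 2"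
  "cremona_diff y z $ 2 = y $ 1 * z $ 3 + y $ 3 * z $ 1"
  "cremona_diff y z $ 3 = y $ 1 * z $ 2 + y $ 2 * z $ 1"
  by (simp_all add: cremona_diff_def vector_3)

lemma has_field_derivative_cremona:
  assumes "\<And>k. ((\<lambda>t. \<eta> t $ k) has_field_derivative d $ k) (at t)"
  shows "((\<lambda>t. cremona (\<eta> t) $ k) has_field_derivative cremona_diff (\<eta> t) d $ k) (at t)"
  using exhaust_3[of k] by (auto intro!: derivative_eq_intros assms simp: algebra_simps)

lemma has_field_derivative_matrix_vector_mult:
  fixes A :: "complex^3^3"
  assumes "\<And>k. ((\<lambda>t. \<eta> t $ k) has_field_derivative d $ k) (at t)"
  shows "((\<lambda>t. (A *v \<eta> t) $ k) has_field_derivative (A *v d) $ k) (at t)"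
  unfolding matrix_vector_mult_def sum_3 vec_lambda_beta
  by (auto intro!: derivative_eq_intros assms)

lemma analytic_matrix_vector_mult:
  fixes A :: "complex^3^3"
  assumes "\<And>k. (\<lambda>t. \<eta> t $ k) analytic_on X"
  shows "(\<lambda>t. (A *v \<eta> t) $ k) analytic_on X"
  unfolding matrix_vector_mult_def sum_3 vec_lambda_beta
  by (intro analytic_intros assms)

lemma analytic_cremona:
  assumes "\<And>k. (\<lambda>t. \<eta> t $ k) analytic_on X"
  shows "(\<lambda>t. cremona (\<eta> t) $ k) analytic_on X"
  using exhaust_3[of k] by (auto intro!: analytic_intros assms)

text \<open>The infinitesimal counterpart of \<open>cprod_cremona\<close>: the join of two image
  points becomes the tangent line at \<open>cremona x\<close>.\<close>

lemma cprod_cremona_diff: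
  assumes "cprod x y = c *s n"
  shows "cprod (cremona x) (cremona_diff x y) = (- c) *s (\<chi> k. (x $ k)^2 * n $ k)"
proof -
  have "x $ 2 * y $ 3 - x $ 3 * y $ 2 = c * n $ 1" "x $ 3 * y $ 1 - x $ 1 * y $ 3 = c * n $ 2"
    "x $ 1 * y $ 2 - x $ 2 * y $ 1 = c * n $ 3"
    using assms unfolding vec3_eq_iff by simp_all
  then show ?thesis unfolding vec3_eq_iff by simp algebra
qed

text \<open>The Cremona map degenerates to zero only at the vertices, which the line
  \<open>n\<close> misses.\<close>

lemma cremona_nonzero:
  fixes n w :: "complex^3"
  assumes "\<forall>k. n $ k \<noteq> 0" "cdot n w = 0" "w \<noteq> 0"
  shows "cremona w \<noteq> 0"
proof
  assume "cremona w = 0"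
  then have "w $ 2 * w $ 3 = 0" "w $ 1 * w $ 3 = 0" "w $ 1 * w $ 2 = 0"
    by (simp_all add: vec3_eq_iff)
  with assms show False by (auto simp: cdot_def vec3_eq_iff)
qed

lemma cdot_cremona_cremona: "cdot n (cremona (cremona w)) = w $ 1 * w $ 2 * w $ 3 * cdot n w"
  by (simp add: cdot_def algebra_simps)

context frame
begin

text \<open>The conic is the image of the line \<open>n\<close>, so the Cremona map applied to an
  affine parametrization of this line near \<open>w\<close> serves. Existence is what gives the
  choice by \<open>SOME\<close> in \<open>intersection_multiplicity\<close> its meaning.\<close>

lemma local_parametrization_exists:
  fixes n w :: "complex^3"
  assumes n: "\<forall>k. n $ k \<noteq> 0" and w: "w \<noteq> 0" "cdot n w = 0"
  shows "\<exists>\<gamma>. local_parametrization (fn.span {cform n}) (point (cremona w)) \<gamma>"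
proof -
  from w(1) obtain j where j: "w $ j \<noteq> 0" by (auto simp: vec_eq_iff)
  \<comment> \<open>A second point of the line \<open>n\<close>, namely its intersection with side
    \<open>j\<close>; it differs from \<open>w\<close> because
    \<open>w $ j \<noteq> 0\<close>.\<close>
  define w' where "w' = cprod n (axis j 1)"
  have w': "cdot n w' = 0" "cprod w w' = w $ j *s n"
    using w(2) exhaust_3[of j]
    by (auto simp: w'_def cprod_cprod) (auto simp: cdot_def vec3_eq_iff axis_def mult.commute)
  define \<gamma> where "\<gamma> t = G *v cremona (w + t *s w')" for t
  have d: "((\<lambda>t. \<gamma> t $ k) has_field_derivative (G *v cremona_diff w w') $ k) (at 0)" for k
  proof -
    have "((\<lambda>t. (w + t *s w') $ k) has_field_derivative w' $ k) (at 0)" for k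
      by (auto intro!: derivative_eq_intros)
    from has_field_derivative_matrix_vector_mult[OF has_field_derivative_cremona[OF this]]
    show ?thesis by (simp add: \<gamma>_def)
  qed
  have "(\<lambda>t. (w + t *s w') $ k) analytic_on {0}" for k
    by (auto intro!: analytic_intros)
  then have an: "(\<lambda>t. \<gamma> t $ k) analytic_on {0}" for k
    unfolding \<gamma>_def by (intro analytic_matrix_vector_mult analytic_cremona)
  have "(\<chi> k. deriv (\<lambda>t. \<gamma> t $ k) 0) = G *v cremona_diff w w'"
    using DERIV_imp_deriv[OF d] by (simp add: vec_eq_iff)
  moreover have "G *v cremona_diff w w' \<notin> point (cremona w)"
  proof
    assume "G *v cremona_diff w w' \<in> point (cremona w)"
    then obtain c where "cremona_diff w w' = c *s cremona w" by (auto simp: mem_point_iff)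
    \<comment> \<open>Coordinate \<open>j\<close> of this product is
      \<open>- (w $ j)^3 * n $ j\<close>, which is nonzero, so the curve is immersed at parameter
      0.\<close>
    then have "cprod (cremona w) (cremona_diff w w') = 0" by (simp add: cprod_scale)
    then have "(w $ j)^2 * n $ j = 0" using j unfolding cprod_cremona_diff[OF w'(2)]
      by (auto simp: vec_eq_iff)
    with n j show False by simp
  qed
  moreover have "f (\<gamma> t) = 0" if "f \<in> fn.span {cform n}" for f t
  proof -
    have "cdot n (w + t *s w') = cdot n w + t * cdot n w'" by (simp add: cdot_def algebra_simps)
    with w(2) w'(1) have "cform n (\<gamma> t) = 0"
      by (simp add: cform_def \<gamma>_def cdot_cremona_cremona)
    with that show ?thesis by (auto simp: fn.span_singleton fscale_def)
  qed
  moreover have "\<gamma> 0 \<in> point (cremona w)" "\<gamma> 0 \<noteq> 0"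
    using cremona_nonzero[OF n w(2,1)] by (auto simp: \<gamma>_def point_def vec.span_base)
  ultimately have "local_parametrization (fn.span {cform n}) (point (cremona w)) \<gamma>"
    using an unfolding local_parametrization_def by auto
  then show ?thesis by blast
qed

lemma point_axis_eq_cremona:
  fixes n :: "complex^3"
  assumes n: "\<forall>k. n $ k \<noteq> 0"
  shows "\<exists>w. w \<noteq> 0 \<and> cdot n w = 0 \<and> point (axis k 1) = point (cremona w)"
proof -
  have "(axis k 1 :: complex^3) \<noteq> 0" by (simp add: axis_eq_0_iff)
  moreover have "cdot n (cremona (axis k 1)) = 0"
    using exhaust_3[of k] by (auto simp: cdot_def axis_def)
  ultimately obtain w c where "w \<noteq> 0" "c \<noteq> 0" "cdot n w = 0" "cremona w = c *s axis k 1"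
    using cremona_surj_on_conic n by metis
  then show ?thesis by (auto simp: point_scale)
qed

text \<open>
  A contact of order two at a base point makes the two conics tangent there: a tangent vector of
  the first one is orthogonal to both gradients.
\<close>

lemma cprod_eq_0_of_tangency:
  fixes m n :: "complex^3"
  assumes n: "\<forall>k. n $ k \<noteq> 0" and m: "m \<noteq> 0"
    and mult: "intersection_multiplicity (fn.span {cform n}) (fn.span {cform m}) (point (axis k 1)) = 2"
  shows "cprod n m $ k = 0"
proof -
  let ?X = "fn.span {cform n}" and ?Y = "fn.span {cform m}" and ?P = "point (axis k 1)"
  \<comment> \<open>\<open>\<gamma>\<close> and \<open>q\<close> are exactly the choices made inside
    \<open>intersection_multiplicity\<close>.\<close>
  define \<gamma> where "\<gamma> = (SOME \<gamma>. local_parametrization ?X ?P \<gamma>)"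
  define q where "q = (SOME q. q \<in> ?Y \<and> q \<noteq> 0)"
  have \<gamma>: "local_parametrization ?X ?P \<gamma>"
    unfolding \<gamma>_def using point_axis_eq_cremona[OF n, of k] local_parametrization_exists[OF n]
    by (metis someI_ex)
  have "cform m \<in> ?Y \<and> cform m \<noteq> 0" using m by (auto simp: fn.span_base cform_eq_0_iff)
  then have "\<exists>q. q \<in> ?Y \<and> q \<noteq> 0" by blast
  then have "q \<in> ?Y \<and> q \<noteq> 0" unfolding q_def by (rule someI_ex)
  then obtain c where c: "q = fscale c (cform m)" and "q \<noteq> 0" by (auto simp: fn.span_singleton)
  then have "c \<noteq> 0" by (auto simp: fscale_def fun_eq_iff)
  have ord: "nat (zorder (\<lambda>t. q (\<gamma> t)) 0) = 2"
    using mult by (auto simp: intersection_multiplicity_def Let_def \<gamma>_def[symmetric] q_def[symmetric]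
        split: if_splits)
  define \<eta> where "\<eta> t = H *v \<gamma> t" for t
  define v where "v = (\<chi> k. deriv (\<lambda>t. \<gamma> t $ k) 0)"
  have an: "(\<lambda>t. \<gamma> t $ k) analytic_on {0}" for k using \<gamma> by (simp add: local_parametrization_def)
  then have "((\<lambda>t. \<gamma> t $ k) has_field_derivative v $ k) (at 0)" for k
    unfolding v_def vec_lambda_beta
    by (intro analytic_derivI)
  from has_field_derivative_matrix_vector_mult[OF this, where A = H]
  have d\<eta>: "((\<lambda>t. \<eta> t $ k) has_field_derivative (H *v v) $ k) (at 0)" for k by (simp add: \<eta>_def)
  have an\<eta>: "(\<lambda>t. cremona (\<eta> t) $ k) analytic_on {0}" for k
    unfolding \<eta>_def by (intro analytic_matrix_vector_mult analytic_cremona an)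
  have an_form: "(\<lambda>t. cform l (\<gamma> t)) analytic_on {0}" for l
    unfolding cform_def cdot_def \<eta>_def[symmetric] by (intro analytic_intros an\<eta>)
  have d_form: "((\<lambda>t. cform l (\<gamma> t)) has_field_derivative cdot l (cremona_diff (\<eta> 0) (H *v v))) (at 0)"
    for l
    unfolding cform_def cdot_def \<eta>_def[symmetric]
    by (intro DERIV_add DERIV_cmult has_field_derivative_cremona d\<eta>)
  have "\<gamma> 0 \<in> ?P" "\<gamma> 0 \<noteq> 0" "v \<notin> ?P" using \<gamma> by (auto simp: local_parametrization_def v_def)
  then obtain e where e: "\<eta> 0 = e *s axis k 1" "e \<noteq> 0"
    by (auto simp: mem_point_iff \<eta>_def) (metis H_eq_0_iff vector_smult_lzero)
  have v: "H *v v \<noteq> c *s axis k 1" for c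
    using \<open>v \<notin> ?P\<close> by (auto simp: mem_point_iff)
  have "\<forall>\<^sub>F t in nhds 0. \<forall>f\<in>?X. f (\<gamma> t) = 0" using \<gamma> by (simp add: local_parametrization_def)
  then have "\<forall>\<^sub>F t in nhds 0. cform n (\<gamma> t) = 0"
    by eventually_elim (auto simp: fn.span_base)
  then have "deriv (\<lambda>t. cform n (\<gamma> t)) 0 = deriv (\<lambda>t. 0) 0" by (rule deriv_cong_ev) simp
  with DERIV_imp_deriv[OF d_form] have 1: "cdot n (cremona_diff (\<eta> 0) (H *v v)) = 0" by simp
  have "(\<lambda>t. q (\<gamma> t)) analytic_on {0}"
    unfolding c fscale_def by (intro analytic_intros an_form)
  with ord have "deriv (\<lambda>t. q (\<gamma> t)) 0 = 0" by (rule deriv_eq_0_of_zorder_eq_2[rotated])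
  moreover have "((\<lambda>t. q (\<gamma> t)) has_field_derivative c * cdot m (cremona_diff (\<eta> 0) (H *v v))) (at 0)"
    unfolding c fscale_def by (intro DERIV_cmult d_form)
  ultimately have 2: "cdot m (cremona_diff (\<eta> 0) (H *v v)) = 0"
    using \<open>c \<noteq> 0\<close> DERIV_imp_deriv by force
  define y where "y = H *v v"
  \<comment> \<open>At vertex \<open>k\<close> coordinate \<open>k\<close> of the differential is
    zero, so orthogonality to \<open>l\<close> is a linear equation in the two other coordinates of
    the tangent vector \<open>y\<close>.\<close>
  have *: "(k = 1 \<longrightarrow> l $ 2 * y $ 3 + l $ 3 * y $ 2 = 0) \<and>
      (k = 2 \<longrightarrow> l $ 1 * y $ 3 + l $ 3 * y $ 1 = 0) \<and>
      (k = 3 \<longrightarrow> l $ 1 * y $ 2 + l $ 2 * y $ 1 = 0)"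
    if "cdot l (cremona_diff (\<eta> 0) y) = 0" for l
  proof -
    have "cdot l (cremona_diff (\<eta> 0) y) = e * cdot l (cremona_diff (axis k 1) y)"
      by (simp add: e cdot_def algebra_simps)
    with that e(2) have "cdot l (cremona_diff (axis k 1) y) = 0" by simp
    then show ?thesis by (auto simp: cdot_def axis_def)
  qed
  have "\<exists>j. j \<noteq> k \<and> y $ j \<noteq> 0"
  proof (rule ccontr)
    assume "\<nexists>j. j \<noteq> k \<and> y $ j \<noteq> 0"
    then have "y = y $ k *s axis k 1" by (auto simp: vec_eq_iff axis_def)
    with v show False by (simp add: y_def)
  qed
  then obtain j where j: "j \<noteq> k" "y $ j \<noteq> 0" by blast
  \<comment> \<open>Immersion makes one of these two coordinates nonzero. The homogeneous equations
    for \<open>n\<close> and \<open>m\<close> thus have a nontrivial solution, and their vanishing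
    determinant is, up to sign, \<open>cprod n m $ k\<close>.\<close>
  have det: "a * d = b * c" if "a * p + b * q = 0" "c * p + d * q = 0" "p \<noteq> 0 \<or> q \<noteq> 0"
    for a b c d p q :: complex
  proof -
    have "(a * d - b * c) * p = 0" "(a * d - b * c) * q = 0" using that(1,2) by algebra+
    with that(3) show ?thesis by auto
  qed
  note n_eq = *[OF 1[folded y_def]] and m_eq = *[OF 2[folded y_def]]
  consider "k = 1" | "k = 2" | "k = 3" using exhaust_3 by blast
  then show ?thesis
  proof cases
    case 1
    with j have "y $ 3 \<noteq> 0 \<or> y $ 2 \<noteq> 0" using exhaust_3[of j] by auto
    with 1 n_eq m_eq show ?thesis using det[of "n $ 2" "y $ 3" "n $ 3" "y $ 2" "m $ 2" "m $ 3"] by simp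
  next
    case 2
    with j have "y $ 3 \<noteq> 0 \<or> y $ 1 \<noteq> 0" using exhaust_3[of j] by auto
    with 2 n_eq m_eq show ?thesis using det[of "n $ 1" "y $ 3" "n $ 3" "y $ 1" "m $ 1" "m $ 3"] by simp
  next
    case 3
    with j have "y $ 2 \<noteq> 0 \<or> y $ 1 \<noteq> 0" using exhaust_3[of j] by auto
    with 3 n_eq m_eq show ?thesis using det[of "n $ 1" "y $ 2" "n $ 2" "y $ 1" "m $ 1" "m $ 2"] by simp
  qed
qed

end

text \<open>Put representatives of the three points in the rows of \<open>R\<close>. A nonzero
  kernel vector of \<open>R\<close> would be the coefficient vector of a line through all three, so
  \<open>R\<close> is invertible and its transpose has the points as columns.\<close>

lemma frame_of_noncollinear:
  assumes "T \<subseteq> CP2" "card T = 3" "\<not> on_common_line T"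
  obtains G H where "frame G H" "T = (\<lambda>k. frame.point G (axis k 1)) ` UNIV"
proof -
  from assms(2) obtain A B C where T: "T = {A, B, C}" by (auto simp: card_3_iff)
  with assms(1) obtain a b c where abc: "A = vec.span {a}" "B = vec.span {b}" "C = vec.span {c}"
    by (auto simp: CP2_def)
  define R where "R = (vector [a, b, c] :: complex^3^3)"
  have "R *v l \<noteq> 0" if "l \<noteq> 0" for l
  proof
    assume *: "R *v l = 0"
    have "cdot l x = 0" if "x \<in> {a,b,c}" for x
      using * that
      by (auto simp: vec3_eq_iff cdot_def matrix_vector_mult_def R_def vector_3 sum_3 mult.commute)
    then have "lies_on P (fn.span {cdot l})" if "P \<in> T" for P
      using that
      by (auto simp: T abc lies_on_def fn.span_singleton vec.span_singleton fscale_def)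
    \<comment> \<open>The identity frame makes \<open>lines_iff\<close> available in ambient
      coordinates.\<close>
    moreover interpret id_frame: frame "mat 1" "mat 1"
      by unfold_locales simp_all
    have "cdot l = id_frame.lform l" by (simp add: id_frame.lform_def fun_eq_iff)
    then have "fn.span {cdot l} \<in> lines" using \<open>l \<noteq> 0\<close> by (auto simp: id_frame.lines_iff)
    ultimately show False using assms(3) by (auto simp: on_common_line_def)
  qed
  then have "\<exists>B. B ** R = mat 1" by (subst matrix_left_invertible_ker) blast
  then obtain Q where Q: "Q ** R = mat 1" "R ** Q = mat 1" by (metis matrix_left_right_inverse)
  then have "frame (transpose R) (transpose Q)"
    by unfold_locales (simp_all add: matrix_transpose_mul[symmetric] transpose_mat)
  then interpret frame "transpose R" "transpose Q" .
  have R: "transpose R *v axis k 1 = R $ k" for k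
    using exhaust_3[of k] by (auto simp: matrix_vector_mult_def transpose_def sum_3 axis_def vec_eq_iff)
  have "point (axis k 1) = vec.span {R $ k}" for k by (simp only: point_def R)
  then have "T = (\<lambda>k. point (axis k 1)) ` UNIV"
    by (simp add: T abc UNIV_3 R_def vector_3)
  with frame_axioms that show thesis by blast
qed

section \<open>The fourth intersection point\<close>

text \<open>Every coordinate of \<open>cremona w\<close> except the one at \<open>k\<close> contains
  the factor \<open>w $ k\<close>; geometrically, a side is contracted to the opposite
  vertex.\<close>

lemma cremona_coordinate_line:
  assumes "w $ k = 0"
  obtains c where "cremona w = c *s axis k 1"
proof -
  from assms have "cremona w = cremona w $ k *s axis k 1"
    using exhaust_3[of k] by (auto simp: vec3_eq_iff axis_def)
  then show thesis by (rule that)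
qed

text \<open>If all three products vanish, one of \<open>x\<close> and \<open>y\<close> has two zero
  coordinates by the pigeonhole principle, and a nonzero point of the line \<open>n\<close>
  cannot.\<close>

lemma hadamard_nonzero:
  fixes n x y :: "complex^3"
  assumes n: "\<forall>k. n $ k \<noteq> 0" and "cdot n x = 0" "x \<noteq> 0" "cdot n y = 0" "y \<noteq> 0"
  shows "(\<chi> k. x $ k * y $ k * n $ k) \<noteq> 0"
proof
  assume "(\<chi> k. x $ k * y $ k * n $ k) = 0"
  with n have *: "x $ k = 0 \<or> y $ k = 0" for k by (simp add: vec_eq_iff)
  have "(1::3) \<noteq> 2" "(1::3) \<noteq> 3" "(2::3) \<noteq> 3" by simp_all
  with *[of 1] *[of 2] *[of 3] two_coords_zeroD[OF n] assms show False by metis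
qed

context frame
begin

text \<open>If \<open>M\<close> is a base point, multiplicity two means tangency there, which puts
  \<open>cprod n m\<close> on the side contracted to that vertex. Otherwise \<open>M\<close> lifts
  to a point \<open>w\<close> of the line \<open>n\<close> off the triangle, and incidence with the
  second conic places \<open>w\<close> on the line \<open>m\<close> too.\<close>

lemma fourth_intersection_point:
  fixes m n :: "complex^3"
  assumes n: "\<forall>k. n $ k \<noteq> 0" and nm: "cprod n m \<noteq> 0" and M: "M \<in> CP2"
    and mult: "\<forall>P\<in>CP2. intersection_multiplicity (fn.span {cform n}) (fn.span {cform m}) P =
      count (mset_set ((\<lambda>k. point (axis k 1)) ` UNIV) + {#M#}) P"
  shows "M = point (cremona (cprod n m))"
proof (cases "M \<in> (\<lambda>k. point (axis k 1)) ` UNIV")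
  case True
  then obtain k where k: "M = point (axis k 1)" by blast
  from nm have "m \<noteq> 0" by (auto simp: vec3_eq_iff)
  \<comment> \<open>The count is 2: once as an element of the set of base points and once as
    \<open>M\<close>.\<close>
  moreover have "intersection_multiplicity (fn.span {cform n}) (fn.span {cform m}) (point (axis k 1)) = 2"
    using mult M True by (simp add: k[symmetric] count_mset_set(1))
  ultimately have "cprod n m $ k = 0" by (rule cprod_eq_0_of_tangency[OF n])
  then obtain c where c: "cremona (cprod n m) = c *s axis k 1" by (rule cremona_coordinate_line)
  moreover have "cremona (cprod n m) \<noteq> 0" using cremona_nonzero[OF n _ nm] by simp
  ultimately have "c \<noteq> 0" by auto
  then show ?thesis by (simp add: k c point_scale)
next
  case False
  \<comment> \<open>The multiplicity is 0 by definition off either curve, so the value 1 yields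
    incidence with both.\<close>
  then have "intersection_multiplicity (fn.span {cform n}) (fn.span {cform m}) M = 1"
    using mult M by (simp add: count_mset_set(3))
  then have on: "lies_on M (fn.span {cform n})" "lies_on M (fn.span {cform m})"
    by (auto simp: intersection_multiplicity_def split: if_splits)
  from M obtain y where y: "y \<noteq> 0" "M = point y" by (rule CP2_point)
  with on have ny: "cdot n (cremona y) = 0" and my: "cdot m (cremona y) = 0"
    by (simp_all add: lies_on_cform_iff)
  from cremona_surj_on_conic[OF n y(1) ny] obtain w c
    where w: "w \<noteq> 0" "c \<noteq> 0" "cdot n w = 0" "cremona w = c *s y" by blast
  have Mw: "M = point (cremona w)" using w y by (simp add: point_scale)
  have "w $ k \<noteq> 0" for k
  proof
    assume "w $ k = 0"
    then obtain d where d: "cremona w = d *s axis k 1" by (rule cremona_coordinate_line)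
    with cremona_nonzero[OF n w(3,1)] have "d \<noteq> 0" by auto
    with d Mw have "M = point (axis k 1)" by (simp add: point_scale)
    with False show False by blast
  qed
  moreover have "w $ 1 * w $ 2 * w $ 3 * cdot m w = 0"
    unfolding cdot_cremona_cremona[symmetric] w(4) cremona_scale by (simp add: my)
  ultimately have "cdot m w = 0" by simp
  then obtain d where d: "w = d *s cprod n m" using orthogonal_eq_scale w(3) nm by blast
  with w(1) have "d \<noteq> 0" by auto
  with Mw show ?thesis by (simp add: d cremona_scale point_scale)
qed

text \<open>
  In the coordinates given by the Cremona map, joining a fixed point of the conic to a moving one
  is linear in the moving point.
\<close>

lemma line_through_conic_points:
  fixes n x y :: "complex^3"
  assumes n: "\<forall>k. n $ k \<noteq> 0" and x: "cdot n x = 0" "x \<noteq> 0" and y: "cdot n y = 0" "y \<noteq> 0"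
    and neq: "point (cremona x) \<noteq> point (cremona y)"
  shows "line_through (point (cremona x)) (point (cremona y)) =
    fn.span {lform (\<chi> k. x $ k * y $ k * n $ k)}"
proof -
  from n have "n \<noteq> 0" by auto
  then obtain c where c: "cprod x y = c *s n" using cprod_of_orthogonal x(1) y(1) by blast
  have "c \<noteq> 0"
  proof
    assume "c = 0"
    with c have "cprod x y = 0" by simp
    then obtain d where d: "x = d *s y" using cprod_eq_0D y(2) by blast
    with x(2) have "d \<noteq> 0" by auto
    with d neq show False by (simp add: cremona_scale point_scale)
  qed
  then have "cprod (cremona x) (cremona y) \<noteq> 0"
    using hadamard_nonzero[OF n x y] by (simp add: cprod_cremona[OF c])
  then show ?thesis
    unfolding line_through_point[OF \<open>cprod (cremona x) (cremona y) \<noteq> 0\<close>] cprod_cremona[OF c]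
    using \<open>c \<noteq> 0\<close> by (intro span_lform_scale) simp
qed

text \<open>Provides infinitely many points on the conic, hence one that avoids any four given ones.
  Two different parameters give independent points of the line \<open>n\<close>, and
  \<open>cprod_cremona\<close> with \<open>hadamard_nonzero\<close> shows that their images are
  independent too.\<close>

lemma inj_conic_parametrization:
  fixes n x y :: "complex^3"
  assumes n: "\<forall>k. n $ k \<noteq> 0" and x: "cdot n x = 0" and y: "cdot n y = 0" and xy: "cprod x y \<noteq> 0"
  shows "inj (\<lambda>t. point (cremona (x + t *s y)))"
proof (rule injI, rule ccontr)
  fix s t assume eq: "point (cremona (x + s *s y)) = point (cremona (x + t *s y))" and "s \<noteq> t"
  have on: "cdot n (x + t *s y) = 0" for t
  proof -
    have "cdot n (x + t *s y) = cdot n x + t * cdot n y" by (simp add: cdot_def algebra_simps)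
    with x y show ?thesis by simp
  qed
  have nz: "x + t *s y \<noteq> 0" for t
  proof
    assume "x + t *s y = 0"
    then have "x = (- t) *s y" by (simp add: eq_neg_iff_add_eq_0)
    with xy show False by (simp add: vec3_eq_iff)
  qed
  from n have "n \<noteq> 0" by auto
  then obtain c where c: "cprod (x + s *s y) (x + t *s y) = c *s n"
    using cprod_of_orthogonal on by blast
  have "cprod (x + s *s y) (x + t *s y) = (t - s) *s cprod x y"
    by (simp add: vec3_eq_iff algebra_simps)
  with c xy \<open>s \<noteq> t\<close> have "c \<noteq> 0" by auto
  have "cprod (cremona (x + s *s y)) (cremona (x + t *s y)) \<noteq> 0"
    using hadamard_nonzero[OF n on nz on nz] \<open>c \<noteq> 0\<close> by (simp add: cprod_cremona[OF c])
  moreover obtain d where "cremona (x + s *s y) = d *s cremona (x + t *s y)"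
    using point_eqD[OF eq cremona_nonzero[OF n on nz]] by blast
  ultimately show False by (simp add: cprod_scale)
qed

end

section \<open>Transfer of the cross ratio from the pencil to the lines through
  \<open>P\<close>\<close>

lemma fn_span_pair:
  assumes "f \<in> fn.span {u, v}"
  obtains s t where "f = fscale s u + fscale t v"
  using assms by (auto simp: fn.span_breakdown_eq fn.span_singleton algebra_simps)

theorem corollary3:
  fixes F :: "(complex^3 \<Rightarrow> complex) set set"
    and \<Gamma> :: "nat \<Rightarrow> (complex^3 \<Rightarrow> complex) set"
    and \<C> :: "(complex^3 \<Rightarrow> complex) set"
    and S T :: "(complex^3) set set"
    and M :: "nat \<Rightarrow> (complex^3) set"
  assumes "nondegenerate_pencil F S"
    and "\<forall>i\<in>{1..4}. \<Gamma> i \<in> F"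
    and "inj_on \<Gamma> {1..4}"
    and "\<C> \<in> conics" and "nondegenerate_conic \<C>" and "\<C> \<notin> F"
    and "T \<subseteq> S" and "card T = 3" and "\<forall>P\<in>T. lies_on P \<C>"
    and "\<forall>i\<in>{1..4}. M i \<in> CP2"
    and "\<forall>i\<in>{1..4}. \<forall>P\<in>CP2.
           intersection_multiplicity \<C> (\<Gamma> i) P = count (mset_set T + {#M i#}) P"
  shows "cross_ratio (\<Gamma> 1) (\<Gamma> 2) (\<Gamma> 3) (\<Gamma> 4) = conic_cross_ratio \<C> (M 1) (M 2) (M 3) (M 4)"
proof -
  from assms(1) obtain W where W: "W \<subseteq> quadratic_forms" "fn.subspace W" "fn.dim W = 2"
    and F: "F = proj_forms W"
    by (auto simp: nondegenerate_pencil_def pencil_def proj_line_def)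
  from assms(1,7,8) have "T \<subseteq> CP2" "\<not> on_common_line T"
    by (auto simp: nondegenerate_pencil_def)
  then obtain G H where GH: "frame G H" and T: "T = (\<lambda>k. frame.point G (axis k 1)) ` UNIV"
    using frame_of_noncollinear assms(8) by blast
  interpret frame G H by (rule GH)
  have base: "G *v axis k 1 \<in> point (axis k 1)" "point (axis k 1) \<in> T" for k
    by (auto simp: T point_def vec.span_base)

  \<comment> \<open>All members of the pencil pass through the frame vertices, so the plane
    \<open>W\<close> consists of forms given by coefficient vectors.\<close>
  have W_cform: "\<exists>m. f = cform m" if "f \<in> W" for f
  proof -
    have "f (G *v axis k 1) = 0" for k
    proof (cases "f = 0")
      case False
      with that have "fn.span {f} \<in> F" by (auto simp: F proj_forms_def)
      with assms(1,7) base have "lies_on (point (axis k 1)) (fn.span {f})"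
        by (auto simp: nondegenerate_pencil_def)
      with base show ?thesis by (auto simp: lies_on_def fn.span_base)
    qed simp
    with that W(1) quadratic_form_eq_cform[of f] show ?thesis by blast
  qed
  obtain B where B: "B \<subseteq> W" "fn.independent B" "W \<subseteq> fn.span B" "card B = fn.dim W"
    by (rule fn.basis_exists)
  then obtain u v where uv: "B = {u, v}" "u \<noteq> v" using W(3) by (auto simp: card_2_iff)
  with B have ind: "lin_indep2 u v" by (simp add: lin_indep2_iff)
  have "u \<in> W" "v \<in> W" using B(1) uv(1) by auto
  then obtain mu mv where m: "u = cform mu" "v = cform mv" using W_cform by meson
  have comb: "fscale a u + fscale b v = cform (a *s mu + b *s mv)" for a b
    by (simp add: m cform_combination)
  have comb_in_W: "cform (a *s mu + b *s mv) \<in> W" for a b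
    unfolding comb[symmetric] using \<open>u \<in> W\<close> \<open>v \<in> W\<close> W(2) by (intro fn.subspace_add fn.subspace_scale)

  from assms(5) obtain A where A: "transpose A = A" "det A \<noteq> 0" "\<C> = fn.span {qform A}"
    by (auto simp: nondegenerate_conic_def)
  have "qform A (G *v axis k 1) = 0" for k
    using assms(9) base[of k] by (auto simp: A(3) lies_on_def fn.span_base)
  then obtain n where "qform A = cform n"
    using quadratic_form_eq_cform[of "qform A"] A(1) by (auto simp: quadratic_forms_def)
  with A have n: "\<forall>k. n $ k \<noteq> 0" and C: "\<C> = fn.span {cform n}"
    using nondegenerate_coeffs_nonzero by auto
  from n have "n \<noteq> 0" by auto

  \<comment> \<open>This is where \<open>\<C> \<notin> F\<close> enters: a vanishing product with a
    nonzero vector would make \<open>n\<close> proportional to the coefficients of a member of the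
    pencil. Hence \<open>cprod n\<close> is injective on the coefficient plane.\<close>
  have nondep: "a = 0 \<and> b = 0" if "cprod n (a *s mu + b *s mv) = 0" for a b
  proof -
    let ?m = "a *s mu + b *s mv"
    have "?m = 0"
    proof (rule ccontr)
      assume m0: "?m \<noteq> 0"
      with that obtain c where c: "n = c *s ?m" using cprod_eq_0D by blast
      with \<open>n \<noteq> 0\<close> have "c \<noteq> 0" by auto
      then have "\<C> = fn.span {cform ?m}"
        unfolding C c by (rule span_cform_scale)
      moreover have "cform ?m \<noteq> 0" using m0 by (simp add: cform_eq_0_iff)
      ultimately show False using comb_in_W assms(6) unfolding F proj_forms_def by blast
    qed
    then have "fscale a u + fscale b v = 0" by (simp add: comb cform_eq_0_iff)
    with ind show ?thesis by (simp add: lin_indep2_def)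
  qed

  have "\<exists>s t. \<Gamma> i = fn.span {fscale s u + fscale t v} \<and> s *s mu + t *s mv \<noteq> 0"
    if "i \<in> {1..4}" for i
  proof -
    from that assms(2) have "\<Gamma> i \<in> proj_forms W" unfolding F by blast
    then obtain f where f: "f \<in> W" "f \<noteq> 0" "\<Gamma> i = fn.span {f}"
      by (auto simp: proj_forms_def)
    with B(3) uv(1) obtain s t where "f = fscale s u + fscale t v" using fn_span_pair by blast
    with f show ?thesis by (auto simp: comb cform_eq_0_iff)
  qed
  then obtain s t where st: "\<And>i. i \<in> {1..4} \<Longrightarrow> \<Gamma> i = fn.span {fscale (s i) u + fscale (t i) v}"
      "\<And>i. i \<in> {1..4} \<Longrightarrow> s i *s mu + t i *s mv \<noteq> 0"
    by metis
  define q where "q i = s i *s mu + t i *s mv" for i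
  have \<Gamma>: "\<Gamma> i = fn.span {cform (q i)}" if "i \<in> {1..4}" for i
    using st(1)[OF that] by (simp add: comb q_def)
  \<comment> \<open>The bracket is the scalar factor of \<open>cprod (q i) (q j)\<close> over
    \<open>cprod mu mv\<close>; if it vanished, \<open>q i\<close> and \<open>q j\<close> would be
    proportional and the two conics equal.\<close>
  have distinct: "s i * t j - s j * t i \<noteq> 0" if i: "i \<in> {1..4}" and j: "j \<in> {1..4}" and "i \<noteq> j" for i j
  proof
    assume *: "s i * t j - s j * t i = 0"
    have "cprod (q i) (q j) = (s i * t j - s j * t i) *s cprod mu mv"
      by (simp add: q_def vec3_eq_iff algebra_simps)
    with * have "cprod (q i) (q j) = 0" by simp
    then obtain c where c: "q i = c *s q j" using cprod_eq_0D st(2)[OF j] q_def by metis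
    with st(2)[OF i] have "c \<noteq> 0" by (auto simp: q_def)
    with c \<Gamma>[OF i] \<Gamma>[OF j] have "\<Gamma> i = \<Gamma> j"
      by (simp add: span_cform_scale)
    with assms(3) i j \<open>i \<noteq> j\<close> show False by (auto dest: inj_onD)
  qed

  \<comment> \<open>\<open>x i\<close> is the intersection of the lines \<open>n\<close> and
    \<open>q i\<close>. It depends linearly on \<open>q i\<close>, so it has the same coordinates
    \<open>s i\<close>, \<open>t i\<close> with respect to \<open>xu\<close> and
    \<open>xv\<close>.\<close>
  define xu xv x where "xu = cprod n mu" and "xv = cprod n mv" and "x i = cprod n (q i)" for i
  have x_comb: "a *s xu + b *s xv = cprod n (a *s mu + b *s mv)" for a b
    by (simp add: xu_def xv_def vec3_eq_iff algebra_simps)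
  have x_nz: "x i \<noteq> 0" if "i \<in> {1..4}" for i
    using nondep[of "s i" "t i"] st(2)[OF that] by (auto simp: x_def q_def)
  have nx: "cdot n (x i) = 0" for i by (simp add: x_def)
  have M: "M i = point (cremona (x i))" if "i \<in> {1..4}" for i
    unfolding x_def
    by (rule fourth_intersection_point[OF n])
      (use that x_nz assms(10,11) in \<open>auto simp: x_def C \<Gamma> T\<close>)

  let ?r = "((s 1 * t 3 - s 3 * t 1) * (s 2 * t 4 - s 4 * t 2)) /
    ((s 2 * t 3 - s 3 * t 2) * (s 1 * t 4 - s 4 * t 1))"
  have key: "cross_ratio (line_through P (M 1)) (line_through P (M 2)) (line_through P (M 3)) (line_through P (M 4)) =
      cross_ratio (\<Gamma> 1) (\<Gamma> 2) (\<Gamma> 3) (\<Gamma> 4)"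
    if P: "P \<in> CP2" "lies_on P \<C>" "P \<notin> {M 1, M 2, M 3, M 4}" for P
  proof -
    from P(1) obtain y where y: "y \<noteq> 0" "P = point y" by (rule CP2_point)
    with P(2) have "cdot n (cremona y) = 0" by (simp add: C lies_on_cform_iff)
    from cremona_surj_on_conic[OF n y(1) this] obtain w c
      where w: "w \<noteq> 0" "c \<noteq> 0" "cdot n w = 0" "cremona w = c *s y" by blast
    have Pw: "P = point (cremona w)" using w y by (simp add: point_scale)
    \<comment> \<open>\<open>h z\<close> is the coefficient vector of the line joining
      \<open>P\<close> to \<open>cremona z\<close>. It is linear in \<open>z\<close> and kills no
      nonzero point of the line \<open>n\<close>, so the joins again have coordinates
      \<open>s i\<close>, \<open>t i\<close>.\<close>
    define h where "h z = (\<chi> k. w $ k * z $ k * n $ k)" for z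
    have h_comb: "fscale a (lform (h xu)) + fscale b (lform (h xv)) = lform (h (a *s xu + b *s xv))" for a b
      by (simp add: lform_combination h_def vec_eq_iff algebra_simps)
        (simp add: fun_eq_iff lform_def cdot_def algebra_simps)
    have "lin_indep2 (lform (h xu)) (lform (h xv))"
      unfolding lin_indep2_def
    proof (intro allI impI)
      fix a b assume "fscale a (lform (h xu)) + fscale b (lform (h xv)) = 0"
      then have "h (a *s xu + b *s xv) = 0" by (simp add: h_comb lform_eq_0_iff)
      then have "cprod n (a *s mu + b *s mv) = 0"
        using hadamard_nonzero[OF n w(3,1) cdot_cprod(1)] unfolding h_def x_comb by blast
      then show "a = 0 \<and> b = 0" by (rule nondep)
    qed
    moreover have "line_through P (M i) = fn.span {fscale (s i) (lform (h xu)) + fscale (t i) (lform (h xv))}"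
      if i: "i \<in> {1..4}" for i
    proof -
      from i have "i = 1 \<or> i = 2 \<or> i = 3 \<or> i = 4" by auto
      with P(3) have "P \<noteq> M i" by auto
      then have "line_through P (M i) = fn.span {lform (h (x i))}"
        unfolding Pw M[OF i] h_def
        by (intro line_through_conic_points n w x_nz[OF i] nx) auto
      also have "x i = s i *s xu + t i *s xv" by (simp add: x_def q_def x_comb)
      finally show ?thesis by (simp add: h_comb)
    qed
    ultimately have "cross_ratio (line_through P (M 1)) (line_through P (M 2))
        (line_through P (M 3)) (line_through P (M 4)) = ?r"
      by (rule cross_ratio_homogeneous[where A = "\<lambda>i. line_through P (M i)"]) (assumption | rule distinct)+
    moreover have "cross_ratio (\<Gamma> 1) (\<Gamma> 2) (\<Gamma> 3) (\<Gamma> 4) = ?r"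
      by (rule cross_ratio_homogeneous[where A = \<Gamma>]) (use ind st(1) distinct in auto)
    ultimately show ?thesis by simp
  qed

  \<comment> \<open>The definite description in \<open>conic_cross_ratio\<close> determines a value
    only if some admissible \<open>P\<close> exists. Independence of \<open>xu\<close> and
    \<open>xv\<close> supplies infinitely many points of \<open>\<C>\<close>, of which at most four
    are excluded.\<close>
  have "cprod xu xv \<noteq> 0"
  proof
    assume *: "cprod xu xv = 0"
    have "xv \<noteq> 0" using nondep[of 0 1] by (auto simp: xv_def)
    with * obtain c where "xu = c *s xv" using cprod_eq_0D by blast
    then have "1 *s xu + (- c) *s xv = 0" by simp
    then show False using nondep[of 1 "- c"] unfolding x_comb by simp
  qed
  then have inj: "inj (\<lambda>t. point (cremona (xu + t *s xv)))"
    by (intro inj_conic_parametrization[OF n]) (simp_all add: xu_def xv_def)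
  then have "infinite (range (\<lambda>t. point (cremona (xu + t *s xv))))"
    using infinite_UNIV_char_0 finite_imageD by blast
  moreover have "finite {M 1, M 2, M 3, M 4}" by simp
  ultimately have "\<not> range (\<lambda>t. point (cremona (xu + t *s xv))) \<subseteq> {M 1, M 2, M 3, M 4}"
    using finite_subset by blast
  then obtain \<tau> where \<tau>: "point (cremona (xu + \<tau> *s xv)) \<notin> {M 1, M 2, M 3, M 4}" by blast
  let ?w = "xu + \<tau> *s xv"
  have w: "?w \<noteq> 0" "cdot n ?w = 0"
    using nondep[of 1 \<tau>] x_comb[of 1 \<tau>] by auto
  let ?P = "point (cremona ?w)"
  have P: "?P \<in> CP2 \<and> lies_on ?P \<C> \<and> ?P \<notin> {M 1, M 2, M 3, M 4}"
    using \<tau> w cremona_nonzero[OF n] by (simp add: point_in_CP2 C lies_on_cform_iff cdot_cremona_cremona)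
  show ?thesis
    unfolding conic_cross_ratio_def
  proof (rule the_equality[symmetric])
    show "\<forall>P\<in>CP2. lies_on P \<C> \<and> P \<notin> {M 1, M 2, M 3, M 4} \<longrightarrow>
      cross_ratio (\<Gamma> 1) (\<Gamma> 2) (\<Gamma> 3) (\<Gamma> 4) =
      cross_ratio (line_through P (M 1)) (line_through P (M 2)) (line_through P (M 3)) (line_through P (M 4))"
      using key by auto
  next
    fix r
    assume "\<forall>P\<in>CP2. lies_on P \<C> \<and> P \<notin> {M 1, M 2, M 3, M 4} \<longrightarrow>
      r = cross_ratio (line_through P (M 1)) (line_through P (M 2)) (line_through P (M 3)) (line_through P (M 4))"
    with P key[of ?P] show "r = cross_ratio (\<Gamma> 1) (\<Gamma> 2) (\<Gamma> 3) (\<Gamma> 4)" by metis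
  qed
qed

end
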